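(* Let $1\le k\le n$ and $q_2\in[0,1]$, and for $\sigma\in\mathfrak S_n$ let $\theta(\sigma)\in\mathfrak S_k$ be the standardisation of its last $k$ letters $(\sigma_{n-k+1}\cdots\sigma_n)$. Then the top-to-random-with-standardisation chain on $\mathfrak S_n$ lumps via $\theta$ to the $\frac{n-k}{n}$-lazy version of the top-to-random-with-standardisation chain on $\mathfrak S_k$, and the binomial-top-to-random-with-standardisation chain on $\mathfrak S_n$ with parameter $q_2$ lumps via $\theta$ to the binomial-top-to-random-with-standardisation chain on $\mathfrak S_k$ with the same parameter $q_2$.
   Context: Standardisation of a string of distinct numbers replaces its letters by $1,2,\dots$ preserving relative order. Top-to-random-with-standardisation chain on $\mathfrak S_m$: from $\sigma$ (one-line notation), remove the first letter, replace the remaining letters by $2,\dots,m$ preserving relative order, and insert the letter $1$ in one of the $m$ positions chosen uniformly. Binomial-top-to-random-with-standardisation chain with parameter $q_2$: choose $r\sim\mathrm{Binomial}(m,1-q_2)$, remove the first $r$ letters, replace the remaining letters by $r+1,\dots,m$ preserving relative order, and insert the letters $1,\dots,r$ so that the result is uniform among the $m!/(m-r)!$ permutations in $\mathfrak S_m$ in which the letters $r+1,\dots,m$ appear in that relative order. The $\alpha$-lazy version of a chain with transition matrix $K$ has transition matrix $\alpha\,\mathrm{id}+(1-\alpha)K$. A chain $\{X_t\}$ lumps via a surjection $\theta$ to $\{\bar X_t\}$ if $\{\theta(X_t)\}$ is a Markov chain with the same transition matrix as $\{\bar X_t\}$. *)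

theory Defs
  imports
    "HOL-Probability.Probability"
    "HOL-Combinatorics.Multiset_Permutations"
begin

definition stochastic_on :: "'s set \<Rightarrow> ('s \<Rightarrow> 's \<Rightarrow> real) \<Rightarrow> bool" where
  "stochastic_on S K \<longleftrightarrow>
     (\<forall>x\<in>S. (\<forall>y\<in>S. 0 \<le> K x y) \<and> (\<Sum>y\<in>S. K x y) = 1)"

text \<open>
  Time-homogeneous discrete-time chains on a finite state space. The initial distribution is
  arbitrary.
\<close>

definition markov_chain ::
    "'w measure \<Rightarrow> 's set \<Rightarrow> ('s \<Rightarrow> 's \<Rightarrow> real) \<Rightarrow> (nat \<Rightarrow> 'w \<Rightarrow> 's) \<Rightarrow> bool" where
  "markov_chain M S K X \<longleftrightarrow>
     prob_space M \<and> finite S \<and> stochastic_on S K \<and>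
     (\<forall>t. X t \<in> measurable M (count_space S)) \<and>
     (\<forall>t x. \<forall>y\<in>S. \<P>(\<omega> in M. \<forall>i\<le>t. X i \<omega> = x i) \<noteq> 0 \<longrightarrow>
        \<P>(\<omega> in M. X (Suc t) \<omega> = y \<bar> \<forall>i\<le>t. X i \<omega> = x i) = K (x t) y)"

text \<open>
  The chain with state space \<open>S\<close> and transition matrix \<open>K\<close> lumps via \<open>\<theta>\<close> to the chain with state
  space \<open>T\<close> and transition matrix \<open>L\<close>: whatever the initial distribution, the image process is a
  Markov chain with transition matrix \<open>L\<close>. The type argument is the sample space on which the
  processes live, since a definition cannot itself quantify over types; it is meant to be left
  as a type variable.
\<close>

definition lumps_via ::
    "'w itself \<Rightarrow> 's set \<Rightarrow> ('s \<Rightarrow> 's \<Rightarrow> real) \<Rightarrow> ('s \<Rightarrow> 'r) \<Rightarrow> 'r set \<Rightarrow> ('r \<Rightarrow> 'r \<Rightarrow> real) \<Rightarrow> bool"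
  where
  "lumps_via _ S K \<theta> T L \<longleftrightarrow>
     \<theta> ` S = T \<and>
     (\<forall>(M :: 'w measure) X. markov_chain M S K X \<longrightarrow> markov_chain M T L (\<lambda>t \<omega>. \<theta> (X t \<omega>)))"

definition lazy_version :: "real \<Rightarrow> ('s \<Rightarrow> 's \<Rightarrow> real) \<Rightarrow> 's \<Rightarrow> 's \<Rightarrow> real" where
  "lazy_version \<alpha> K x y = \<alpha> * (if x = y then 1 else 0) + (1 - \<alpha>) * K x y"

abbreviation perms :: "nat \<Rightarrow> nat list set" where
  "perms m \<equiv> permutations_of_set {1..m}"

definition standardise :: "nat list \<Rightarrow> nat list" where
  "standardise xs = map (\<lambda>x. card {y \<in> set xs. y \<le> x}) xs"

definition remove_top :: "nat \<Rightarrow> nat list \<Rightarrow> nat list" where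
  "remove_top r \<sigma> = map (\<lambda>x. r + x) (standardise (drop r \<sigma>))"

definition top_to_random_step :: "nat \<Rightarrow> nat list \<Rightarrow> nat list pmf" where
  "top_to_random_step m \<sigma> =
     map_pmf (\<lambda>i. take i (remove_top 1 \<sigma>) @ 1 # drop i (remove_top 1 \<sigma>)) (pmf_of_set {..<m})"

definition top_to_random :: "nat \<Rightarrow> nat list \<Rightarrow> nat list \<Rightarrow> real" where
  "top_to_random m \<sigma> \<tau> = pmf (top_to_random_step m \<sigma>) \<tau>"

definition binomial_top_to_random_step :: "nat \<Rightarrow> real \<Rightarrow> nat list \<Rightarrow> nat list pmf" where
  "binomial_top_to_random_step m q\<^sub>2 \<sigma> =
     bind_pmf (binomial_pmf m (1 - q\<^sub>2))
       (\<lambda>r. pmf_of_set {\<tau> \<in> perms m. filter (\<lambda>x. r < x) \<tau> = remove_top r \<sigma>})"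

definition binomial_top_to_random :: "nat \<Rightarrow> real \<Rightarrow> nat list \<Rightarrow> nat list \<Rightarrow> real" where
  "binomial_top_to_random m q\<^sub>2 \<sigma> \<tau> = pmf (binomial_top_to_random_step m q\<^sub>2 \<sigma>) \<tau>"

end

theory Submission
  imports Defs
begin

text \<open>
  A function \<open>\<theta>\<close> lumps a chain as soon as the transition probabilities from \<open>x\<close>, summed over the
  fibre of \<open>y\<close>, depend only on \<open>\<theta> x\<close> and \<open>y\<close> (Dynkin's criterion): sum over all paths of the
  original chain that lie above a given path.

  For top-to-random, inserting the letter 1 into one of the first \<open>n - k\<close> positions leaves the
  standardisation of the last \<open>k\<close> letters unchanged; otherwise it is a uniform insertion among the
  last \<open>k\<close> positions.

  The binomial chain gives \<open>\<tau>\<close> the probability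
  \<open>(\<Sum>r\<le>m. (1 - q) ^ r * q ^ (m - r) / fact r * [\<tau> retains \<sigma> after removing r letters])\<close>.
  Since standardisation commutes with dropping letters, it suffices to drop one letter. The fibre
  of \<open>\<tau>\<close> is then parametrised by the first letter \<open>a\<close>. Each of the \<open>r\<close> letters \<open>a \<le> r\<close> reduces the
  condition for \<open>r\<close> to the one for \<open>r - 1\<close> in the smaller chain, and exactly one letter \<open>a > r\<close>
  reduces it to the one for \<open>r\<close>. The two contributions carry the total weights \<open>1 - q\<close> and \<open>q\<close>.
  The same recursion counts the permutations over which the insertion is uniform.
\<close>

section \<open>Standardisation\<close>

text \<open>Fixing the set separately from the letter makes standardisation a \<open>map\<close> of
  one function, strictly increasing on the letters; everything below uses only this.\<close>

definition rank_in :: "'a::linorder set \<Rightarrow> 'a \<Rightarrow> nat" where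
  "rank_in A x = card {y \<in> A. y \<le> x}"

lemma standardise_rank: "standardise xs = map (rank_in (set xs)) xs"
  by (simp add: standardise_def rank_in_def)

lemma strict_mono_on_rank:
  assumes "finite A"
  shows "strict_mono_on A (rank_in A)"
proof (rule strict_mono_onI)
  fix x y assume "x \<in> A" "y \<in> A" "x < y"
  then have "{z \<in> A. z \<le> x} \<subset> {z \<in> A. z \<le> y}"
    by force
  with assms show "rank_in A x < rank_in A y"
    unfolding rank_in_def by (intro psubset_card_mono) auto
qed

lemma rank_image:
  fixes f :: "'a::linorder \<Rightarrow> 'b::linorder"
  assumes "strict_mono_on A f" "x \<in> A"
  shows "rank_in (f ` A) (f x) = rank_in A x"
proof -
  have "{y \<in> f ` A. y \<le> f x} = f ` {y \<in> A. y \<le> x}"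
    using assms by (auto simp: strict_mono_on_less_eq)
  moreover have "inj_on f {y \<in> A. y \<le> x}"
    using strict_mono_on_imp_inj_on[OF assms(1)] by (rule inj_on_subset) auto
  ultimately show ?thesis
    by (simp add: rank_in_def card_image)
qed

lemma rank_image_self:
  assumes "finite A"
  shows "rank_in A ` A = {1..card A}"
proof (rule card_subset_eq)
  show "rank_in A ` A \<subseteq> {1..card A}"
  proof
    fix v assume "v \<in> rank_in A ` A"
    then obtain x where x: "x \<in> A" "v = rank_in A x" by auto
    have "card {x} \<le> rank_in A x"
      unfolding rank_in_def by (rule card_mono) (use x assms in auto)
    moreover have "rank_in A x \<le> card A"
      unfolding rank_in_def by (rule card_mono) (use assms in auto)
    ultimately show "v \<in> {1..card A}" using x by simp
  qed
  show "card (rank_in A ` A) = card {1..card A}"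
    using strict_mono_on_imp_inj_on[OF strict_mono_on_rank[OF assms]] by (simp add: card_image)
qed simp

lemma length_standardise [simp]: "length (standardise xs) = length xs"
  by (simp add: standardise_def)

lemma standardise_map:
  assumes "strict_mono_on (set xs) f"
  shows "standardise (map f xs) = standardise xs"
  using assms by (simp add: standardise_rank rank_image)

text \<open>Ranks within the whole list are an increasing relabelling of the letters that stay, and
  standardisation does not see such a relabelling. Hence successive drops compose.\<close>

lemma standardise_drop: "standardise (drop d (standardise xs)) = standardise (drop d xs)"
proof -
  have "strict_mono_on (set (drop d xs)) (rank_in (set xs))"
    using strict_mono_on_rank[of "set xs"] set_drop_subset[of d xs]
    by (auto simp: strict_mono_on_def)
  then show ?thesis
    by (simp add: standardise_rank[of xs] drop_map standardise_map)
qed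

lemma standardise_eq_self:
  assumes "set xs = {1..m}"
  shows "standardise xs = xs"
proof -
  have "rank_in {1..m} x = x" if "x \<in> {1..m}" for x
  proof -
    have "{y \<in> {1..m}. y \<le> x} = {1..x}" using that by auto
    then show ?thesis by (simp add: rank_in_def)
  qed
  with assms show ?thesis
    unfolding standardise_rank by (intro map_idI) auto
qed

lemma standardise_in_perms: "distinct xs \<Longrightarrow> standardise xs \<in> perms (length xs)"
  using strict_mono_on_imp_inj_on[OF strict_mono_on_rank[of "set xs"]]
  by (auto simp: permutations_of_set_def standardise_rank distinct_map rank_image_self
      distinct_card)

text \<open>Both lists are relabelled by the same injective rank function. Later this identifies a
  list from its letter set and its pattern.\<close>

lemma standardise_inject:
  assumes "standardise xs = standardise ys" "set xs = set ys"
  shows "xs = ys"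
proof -
  have "inj_on (rank_in (set xs)) (set xs \<union> set ys)"
    using strict_mono_on_imp_inj_on[OF strict_mono_on_rank[of "set xs"]] assms(2) by simp
  with assms show ?thesis
    by (auto simp: standardise_rank dest: map_inj_on)
qed

lemma length_perms: "\<sigma> \<in> perms m \<Longrightarrow> length \<sigma> = m"
  by (auto dest: length_finite_permutations_of_set)

lemma perms_standardise_drop:
  "\<sigma> \<in> perms n \<Longrightarrow> standardise (drop d \<sigma>) \<in> perms (n - d)"
  using standardise_in_perms[of "drop d \<sigma>"] length_perms[of \<sigma> n]
  by (auto simp: permutations_of_set_def)

lemma standardise_drop_image_perms:
  assumes "k \<le> n"
  shows "(\<lambda>\<sigma>. standardise (drop (n - k) \<sigma>)) ` perms n = perms k"
proof
  show "(\<lambda>\<sigma>. standardise (drop (n - k) \<sigma>)) ` perms n \<subseteq> perms k"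
    using perms_standardise_drop[of _ n "n - k"] assms by auto
  show "perms k \<subseteq> (\<lambda>\<sigma>. standardise (drop (n - k) \<sigma>)) ` perms n"
  proof
    fix \<tau> assume \<tau>: "\<tau> \<in> perms k"
    \<comment> \<open>A preimage of \<tau>: the missing letters \<open>Suc k..n\<close> go in front,
      in increasing order.\<close>
    then have "[Suc k..<Suc n] @ \<tau> \<in> perms n"
      using assms by (auto simp: permutations_of_set_def)
    moreover have "standardise (drop (n - k) ([Suc k..<Suc n] @ \<tau>)) = \<tau>"
      using standardise_eq_self[of \<tau> k] \<tau>
      by (simp add: permutations_of_set_def del: upt_Suc)
    ultimately show "\<tau> \<in> (\<lambda>\<sigma>. standardise (drop (n - k) \<sigma>)) ` perms n"
      by (metis (no_types, lifting) image_eqI)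
  qed
qed

section \<open>Lumping criterion\<close>

lemma lumps_via_fibre_sums:
  assumes onto: "\<theta> ` S = T"
    and fib: "\<And>x y. x \<in> S \<Longrightarrow> y \<in> T \<Longrightarrow> (\<Sum>x' | x' \<in> S \<and> \<theta> x' = y. K x x') = L (\<theta> x) y"
  shows "lumps_via TYPE('w) S K \<theta> T L"
  unfolding lumps_via_def
proof (intro conjI onto allI impI)
  fix M :: "'w measure" and X
  assume mc: "markov_chain M S K X"
  then interpret prob_space M by (simp add: markov_chain_def)
  have fin: "finite S" and stoch: "stochastic_on S K"
    and meas [measurable]: "\<And>t. X t \<in> measurable M (count_space S)"
    and trans: "\<And>t x y. y \<in> S \<Longrightarrow> \<P>(\<omega> in M. \<forall>i\<le>t. X i \<omega> = x i) \<noteq> 0 \<Longrightarrow>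
        \<P>(\<omega> in M. X (Suc t) \<omega> = y \<bar> \<forall>i\<le>t. X i \<omega> = x i) = K (x t) y"
    using mc by (auto simp: markov_chain_def)
  have finT: "finite T" using fin onto by auto
  have XS: "X t \<omega> \<in> S" if "\<omega> \<in> space M" for t \<omega>
    using measurable_space[OF meas that] by simp
  have path_meas [measurable]: "{\<omega> \<in> space M. \<forall>i\<le>t. X i \<omega> = x i} \<in> sets M" for t x
  proof -
    have "{\<omega> \<in> space M. X i \<omega> = x i} \<in> sets M" for i
    proof -
      \<comment> \<open>The value \<open>x i\<close> may lie outside \<open>S\<close>; intersecting
        with \<open>S\<close> gives a set of \<open>count_space S\<close>.\<close>
      have "{\<omega> \<in> space M. X i \<omega> = x i} = X i -` ({x i} \<inter> S) \<inter> space M" using XS by auto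
      then show ?thesis using measurable_sets[OF meas, of "{x i} \<inter> S" i] by simp
    qed
    then show ?thesis by (intro sets.sets_Collect) auto
  qed
  \<comment> \<open>The product form of the Markov property also holds for paths of probability
    zero, as both sides vanish, so it can be summed over all paths.\<close>
  have step: "\<P>(\<omega> in M. X (Suc t) \<omega> = y \<and> (\<forall>i\<le>t. X i \<omega> = x i)) =
      K (x t) y * \<P>(\<omega> in M. \<forall>i\<le>t. X i \<omega> = x i)" if "y \<in> S" for t x y
  proof (cases "\<P>(\<omega> in M. \<forall>i\<le>t. X i \<omega> = x i) = 0")
    case True
    have "\<P>(\<omega> in M. X (Suc t) \<omega> = y \<and> (\<forall>i\<le>t. X i \<omega> = x i)) \<le> \<P>(\<omega> in M. \<forall>i\<le>t. X i \<omega> = x i)"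
      by (intro finite_measure_mono path_meas) auto
    with True show ?thesis by (simp add: measure_le_0_iff)
  next
    case False
    from trans[OF that this] False show ?thesis
      unfolding cond_prob_def by (simp add: field_simps)
  qed
  have step_meas [measurable]: "{\<omega> \<in> space M. X (Suc t) \<omega> = y \<and> (\<forall>i\<le>t. X i \<omega> = x i)} \<in> sets M" for t x y
  proof -
    have "{\<omega> \<in> space M. X (Suc t) \<omega> = y \<and> (\<forall>i\<le>t. X i \<omega> = x i)} =
      {\<omega> \<in> space M. \<forall>i\<le>Suc t. X i \<omega> = (x(Suc t := y)) i}" by (auto simp: le_Suc_eq)
    then show ?thesis using path_meas by simp
  qed
  show "markov_chain M T L (\<lambda>t \<omega>. \<theta> (X t \<omega>))"
    unfolding markov_chain_def
  proof (intro conjI allI impI ballI)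
    show "prob_space M" by (rule prob_space_axioms)
    show "finite T" by fact
    \<comment> \<open>As \<theta> is onto, each row of \<open>L\<close> consists of the fibre sums
      of some row of \<open>K\<close>, and the fibres partition \<open>S\<close>.\<close>
    show "stochastic_on T L"
      unfolding stochastic_on_def
    proof (intro ballI conjI)
      fix u assume "u \<in> T"
      then obtain x where x: "x \<in> S" "u = \<theta> x" using onto by auto
      show "0 \<le> L u y" if "y \<in> T" for y
        using fib[OF x(1) that] x stoch by (auto simp: stochastic_on_def intro!: sum_nonneg dest!: sym[of _ "L (\<theta> x) y"])
      have "(\<Sum>y\<in>T. L u y) = (\<Sum>y\<in>T. \<Sum>x' | x' \<in> S \<and> \<theta> x' = y. K x x')"
        using fib x by simp
      also have "\<dots> = (\<Sum>x'\<in>S. K x x')"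
        using fin finT onto by (intro sum.group) auto
      finally show "(\<Sum>y\<in>T. L u y) = 1" using stoch x by (simp add: stochastic_on_def)
    qed
    show "(\<lambda>\<omega>. \<theta> (X t \<omega>)) \<in> measurable M (count_space T)" for t
    proof -
      have "\<theta> \<in> measurable (count_space S) (count_space T)" using onto by auto
      then show ?thesis by (rule measurable_compose[OF meas])
    qed
    fix t u y
    assume y: "y \<in> T" and nz: "\<P>(\<omega> in M. \<forall>i\<le>t. \<theta> (X i \<omega>) = u i) \<noteq> 0"
    \<comment> \<open>The paths above \<open>u\<close>. Being extensional (\<open>PiE\<close>), they
      are finite in number, and two distinct ones differ at some time up to \<open>t\<close>, so
      their events are disjoint.\<close>
    define A where "A = {x \<in> PiE {..t} (\<lambda>_. S). \<forall>i\<le>t. \<theta> (x i) = u i}"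
    define B where "B = {x' \<in> S. \<theta> x' = y}"
    have finA: "finite A" unfolding A_def using fin by (intro finite_Collect_conjI disjI1) (simp add: finite_PiE)
    have A_eqI: "x = x'" if "x \<in> A" "x' \<in> A" "\<forall>i\<le>t. x i = x' i" for x x'
      using that unfolding A_def by (auto intro: PiE_ext)
    have finB: "finite B" unfolding B_def using fin by auto
    have "\<P>(\<omega> in M. \<forall>i\<le>t. \<theta> (X i \<omega>) = u i) =
        measure M (\<Union>x\<in>A. {\<omega> \<in> space M. \<forall>i\<le>t. X i \<omega> = x i})"
    proof (rule arg_cong[where f = "measure M"], intro equalityI subsetI)
      fix \<omega> assume "\<omega> \<in> {\<omega> \<in> space M. \<forall>i\<le>t. \<theta> (X i \<omega>) = u i}"
      then have "restrict (\<lambda>i. X i \<omega>) {..t} \<in> A"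
        "\<omega> \<in> {\<omega>' \<in> space M. \<forall>i\<le>t. X i \<omega>' = restrict (\<lambda>i. X i \<omega>) {..t} i}"
        unfolding A_def using XS by auto
      then show "\<omega> \<in> (\<Union>x\<in>A. {\<omega> \<in> space M. \<forall>i\<le>t. X i \<omega> = x i})" by blast
    qed (auto simp: A_def)
    also have "\<dots> = (\<Sum>x\<in>A. \<P>(\<omega> in M. \<forall>i\<le>t. X i \<omega> = x i))"
    proof (rule finite_measure_finite_Union[OF finA])
      show "disjoint_family_on (\<lambda>x. {\<omega> \<in> space M. \<forall>i\<le>t. X i \<omega> = x i}) A"
        unfolding disjoint_family_on_def using A_eqI by fastforce
    qed (use path_meas in auto)
    finally have past: "\<P>(\<omega> in M. \<forall>i\<le>t. \<theta> (X i \<omega>) = u i) =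
      (\<Sum>x\<in>A. \<P>(\<omega> in M. \<forall>i\<le>t. X i \<omega> = x i))" .
    have "\<P>(\<omega> in M. \<theta> (X (Suc t) \<omega>) = y \<and> (\<forall>i\<le>t. \<theta> (X i \<omega>) = u i)) =
        measure M (\<Union>(x, x')\<in>A \<times> B. {\<omega> \<in> space M. X (Suc t) \<omega> = x' \<and> (\<forall>i\<le>t. X i \<omega> = x i)})"
    proof (rule arg_cong[where f = "measure M"], intro equalityI subsetI)
      fix \<omega> assume "\<omega> \<in> {\<omega> \<in> space M. \<theta> (X (Suc t) \<omega>) = y \<and> (\<forall>i\<le>t. \<theta> (X i \<omega>) = u i)}"
      then have "(restrict (\<lambda>i. X i \<omega>) {..t}, X (Suc t) \<omega>) \<in> A \<times> B"
        "\<omega> \<in> {\<omega>' \<in> space M. X (Suc t) \<omega>' = X (Suc t) \<omega> \<and>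
           (\<forall>i\<le>t. X i \<omega>' = restrict (\<lambda>i. X i \<omega>) {..t} i)}"
        unfolding A_def B_def using XS by auto
      then show "\<omega> \<in> (\<Union>(x, x')\<in>A \<times> B. {\<omega> \<in> space M. X (Suc t) \<omega> = x' \<and> (\<forall>i\<le>t. X i \<omega> = x i)})"
        by blast
    qed (auto simp: A_def B_def)
    also have "\<dots> = (\<Sum>(x, x')\<in>A \<times> B. \<P>(\<omega> in M. X (Suc t) \<omega> = x' \<and> (\<forall>i\<le>t. X i \<omega> = x i)))"
      unfolding case_prod_unfold
    proof (rule finite_measure_finite_Union)
      show "disjoint_family_on (\<lambda>p. {\<omega> \<in> space M. X (Suc t) \<omega> = snd p \<and>
          (\<forall>i\<le>t. X i \<omega> = fst p i)}) (A \<times> B)"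
        unfolding disjoint_family_on_def using A_eqI by fastforce
    qed (use step_meas finA finB in auto)
    also have "\<dots> = (\<Sum>x\<in>A. \<Sum>x'\<in>B. K (x t) x' * \<P>(\<omega> in M. \<forall>i\<le>t. X i \<omega> = x i))"
      by (simp add: sum.cartesian_product[symmetric] step B_def)
    \<comment> \<open>By the fibre hypothesis the inner sum gives the same factor for every path
      above \<open>u\<close>; only the last state \<open>x t\<close> enters, through its image
      \<open>u t\<close>.\<close>
    also have "\<dots> = (\<Sum>x\<in>A. L (u t) y * \<P>(\<omega> in M. \<forall>i\<le>t. X i \<omega> = x i))"
    proof (rule sum.cong[OF refl])
      fix x assume "x \<in> A"
      then have "x t \<in> S" "\<theta> (x t) = u t" by (auto simp: A_def)
      then show "(\<Sum>x'\<in>B. K (x t) x' * \<P>(\<omega> in M. \<forall>i\<le>t. X i \<omega> = x i)) =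
          L (u t) y * \<P>(\<omega> in M. \<forall>i\<le>t. X i \<omega> = x i)"
        using fib[of "x t" y] y by (simp add: sum_distrib_right[symmetric] B_def)
    qed
    also have "\<dots> = L (u t) y * \<P>(\<omega> in M. \<forall>i\<le>t. \<theta> (X i \<omega>) = u i)"
      by (simp add: past sum_distrib_left)
    finally show "\<P>(\<omega> in M. \<theta> (X (Suc t) \<omega>) = y \<bar> \<forall>i\<le>t. \<theta> (X i \<omega>) = u i) = L (u t) y"
      using nz unfolding cond_prob_def by simp
  qed
qed

section \<open>Top-to-random\<close>

lemma set_perms: "\<sigma> \<in> perms m \<Longrightarrow> set \<sigma> = {1..m}"
  by (simp add: permutations_of_set_def)

lemma distinct_perms: "\<sigma> \<in> perms m \<Longrightarrow> distinct \<sigma>"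
  by (simp add: permutations_of_set_def)

lemma remove_top_in_permutations:
  assumes "\<sigma> \<in> perms m" "r \<le> m"
  shows "remove_top r \<sigma> \<in> permutations_of_set {Suc r..m}"
proof -
  have "standardise (drop r \<sigma>) \<in> perms (m - r)"
    using assms perms_standardise_drop by blast
  moreover have "(+) r ` {1..m - r} = {Suc r..m}"
    using assms(2) by simp
  ultimately show ?thesis
    by (simp add: permutations_of_set_def remove_top_def distinct_map)
qed

section \<open>Inserting one letter into a list\<close>

definition insert_at :: "nat \<Rightarrow> 'a \<Rightarrow> 'a list \<Rightarrow> 'a list" where
  "insert_at i x xs = take i xs @ x # drop i xs"

lemma set_insert_at [simp]: "set (insert_at i x xs) = insert x (set xs)"
  unfolding insert_at_def by (metis Un_insert_right append_take_drop_id list.simps(15) set_append)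

lemma distinct_insert_at [simp]: "distinct (insert_at i x xs) \<longleftrightarrow> x \<notin> set xs \<and> distinct xs"
proof -
  have "mset (insert_at i x xs) = mset (x # xs)"
    unfolding insert_at_def
    by (metis append_take_drop_id mset.simps(2) mset_append union_mset_add_mset_right)
  then have "distinct (insert_at i x xs) \<longleftrightarrow> distinct (x # xs)"
    by (rule mset_eq_imp_distinct_iff)
  then show ?thesis by simp
qed

lemma map_insert_at: "map f (insert_at i x xs) = insert_at i (f x) (map f xs)"
  by (simp add: insert_at_def take_map drop_map)

lemma drop_insert_at_ge:
  assumes "i < d" "i \<le> length xs"
  shows "drop d (insert_at i x xs) = drop (d - 1) xs"
proof -
  have "d = Suc (i + (d - Suc i))" using assms by simp
  then obtain e where e: "d = Suc (i + e)" by blast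
  show ?thesis using assms by (simp add: insert_at_def e add.commute)
qed

lemma drop_insert_at_le:
  assumes "d + j \<le> length xs"
  shows "drop d (insert_at (d + j) x xs) = insert_at j x (drop d xs)"
  using assms by (simp add: insert_at_def drop_take add.commute)

text \<open>Since 0 is absent from \<open>ys\<close>, the inserted 1 is smaller than all shifted
  letters: it has rank 1 and pushes every other rank up by one.\<close>

lemma standardise_insert_at:
  assumes "distinct ys" "0 \<notin> set ys"
  shows "standardise (insert_at j 1 (map Suc ys)) = insert_at j 1 (map Suc (standardise ys))"
proof -
  \<comment> \<open>An increasing relabelling of the letters of the inserted list. It preserves the
    standardisation, and its output is already standardised.\<close>
  define f where "f x = (if x = 1 then 1 else Suc (rank_in (set ys) (x - 1)))" for x :: nat
  have perm: "standardise ys \<in> perms (length ys)"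
    by (rule standardise_in_perms) fact
  have pos: "rank_in (set ys) x > 0" if "x \<in> set ys" for x
    using rank_image_self[of "set ys"] that by fastforce
  have f_eq: "map f (insert_at j 1 (map Suc ys)) = insert_at j 1 (map Suc (standardise ys))"
  proof -
    have "map f (map Suc ys) = map Suc (standardise ys)"
      using assms(2) by (auto simp: standardise_rank f_def)
    then show ?thesis by (simp add: map_insert_at f_def)
  qed
  have "strict_mono_on (set (insert_at j 1 (map Suc ys))) f"
    using strict_mono_on_rank[of "set ys"] assms(2) pos
    by (auto simp: f_def strict_mono_on_def)
  then have "standardise (insert_at j 1 (map Suc ys)) = standardise (map f (insert_at j 1 (map Suc ys)))"
    by (rule standardise_map[symmetric])
  also have "\<dots> = map f (insert_at j 1 (map Suc ys))"
  proof (rule standardise_eq_self)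
    show "set (map f (insert_at j 1 (map Suc ys))) = {1..Suc (length ys)}"
      using set_perms[OF perm] unfolding f_eq by (auto simp: image_Suc_atLeastAtMost)
  qed
  finally show ?thesis using f_eq by simp
qed

lemma top_to_random_fibre_sum:
  assumes k: "1 \<le> k" "k \<le> n" and \<sigma>: "\<sigma> \<in> perms n" and \<tau>: "\<tau> \<in> perms k"
  shows "(\<Sum>\<sigma>' | \<sigma>' \<in> perms n \<and> standardise (drop (n - k) \<sigma>') = \<tau>. top_to_random n \<sigma> \<sigma>') =
    lazy_version ((real n - real k) / real n) (top_to_random k) (standardise (drop (n - k) \<sigma>)) \<tau>"
proof -
  define \<theta> where "\<theta> = (\<lambda>\<sigma>. standardise (drop (n - k) \<sigma>))"
  define s where "s = standardise (drop 1 \<sigma>)"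
  have s: "s \<in> perms (n - 1)"
    unfolding s_def by (rule perms_standardise_drop) fact
  note s' = length_perms[OF s] set_perms[OF s] distinct_perms[OF s]
  have step: "top_to_random m \<rho> \<rho>' =
      card {i. i < m \<and> insert_at i 1 (remove_top 1 \<rho>) = \<rho>'} / m" if "m > 0" for m \<rho> \<rho>'
  proof -
    have "{..<m} \<inter> (\<lambda>i. insert_at i 1 (remove_top 1 \<rho>)) -` {\<rho>'} =
      {i. i < m \<and> insert_at i 1 (remove_top 1 \<rho>) = \<rho>'}" by auto
    with that show ?thesis
      by (simp add: top_to_random_def top_to_random_step_def pmf_map measure_pmf_of_set
          insert_at_def lessThan_empty_iff)
  qed
  have R: "remove_top 1 \<sigma> = map Suc s"
    by (simp add: remove_top_def s_def)
  \<comment> \<open>The list \<open>s\<close> has one letter fewer than \<sigma>, so dropping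
    \<open>n - k\<close> of its letters leaves the pattern of the last \<open>k - 1\<close> letters
    of \<sigma>.\<close>
  have R': "remove_top 1 (\<theta> \<sigma>) = map Suc (standardise (drop (n - k) s))"
    by (simp add: remove_top_def s_def \<theta>_def standardise_drop add.commute)
  have perm: "insert_at i 1 (map Suc s) \<in> perms n" for i
    using s' k by (auto simp: permutations_of_set_def distinct_map image_Suc_atLeastAtMost)
  \<comment> \<open>The new 1 falls into the dropped part, so only \<open>n - k - 1\<close> letters
    of \<open>s\<close> are dropped with it, and the last \<open>k\<close> letters of \<sigma>
    survive.\<close>
  have high: "\<theta> (insert_at i 1 (map Suc s)) = \<theta> \<sigma>" if "i < n - k" for i
  proof -
    have "\<theta> (insert_at i 1 (map Suc s)) = standardise (map Suc (drop (n - k - 1) s))"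
      using that k s' by (simp add: \<theta>_def drop_insert_at_ge drop_map)
    also have "\<dots> = standardise (drop (n - k - 1) s)"
      by (rule standardise_map) (simp add: strict_mono_on_def)
    also have "\<dots> = \<theta> \<sigma>"
      using that by (simp add: s_def standardise_drop \<theta>_def Suc_diff_Suc)
    finally show ?thesis .
  qed
  \<comment> \<open>The new 1 survives at position \<open>j\<close> of the kept part, and the first
    of the old last \<open>k\<close> letters is pushed out: a step of the small chain.\<close>
  have low: "\<theta> (insert_at (n - k + j) 1 (map Suc s)) = insert_at j 1 (remove_top 1 (\<theta> \<sigma>))"
    if "j < k" for j
  proof -
    have "0 \<notin> set (drop (n - k) s)" "distinct (drop (n - k) s)"
      using s' set_drop_subset[of "n - k" s] by auto
    moreover have "\<theta> (insert_at (n - k + j) 1 (map Suc s)) =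
        standardise (insert_at j 1 (map Suc (drop (n - k) s)))"
      using drop_insert_at_le[of "n - k" j "map Suc s" 1] that k s' by (simp add: \<theta>_def drop_map)
    ultimately show ?thesis
      using standardise_insert_at R' by simp
  qed
  have "(\<Sum>\<sigma>' | \<sigma>' \<in> perms n \<and> \<theta> \<sigma>' = \<tau>. top_to_random n \<sigma> \<sigma>') =
      measure (top_to_random_step n \<sigma>) {\<sigma>' \<in> perms n. \<theta> \<sigma>' = \<tau>}"
    by (simp add: top_to_random_def measure_measure_pmf_finite)
  also have "\<dots> = card ({..<n} \<inter> (\<lambda>i. insert_at i 1 (map Suc s)) -` {\<sigma>' \<in> perms n. \<theta> \<sigma>' = \<tau>}) / n"
    using k by (simp add: top_to_random_step_def measure_pmf_of_set R insert_at_def lessThan_empty_iff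
        flip: One_nat_def)
  also have "{..<n} \<inter> (\<lambda>i. insert_at i 1 (map Suc s)) -` {\<sigma>' \<in> perms n. \<theta> \<sigma>' = \<tau>} =
      {i. i < n \<and> \<theta> (insert_at i 1 (map Suc s)) = \<tau>}"
    using perm by auto
  also have "\<dots> = {i. i < n - k \<and> \<theta> \<sigma> = \<tau>} \<union>
      (+) (n - k) ` {j. j < k \<and> insert_at j 1 (remove_top 1 (\<theta> \<sigma>)) = \<tau>}" (is "?L = ?H \<union> ?I")
  proof (intro equalityI subsetI)
    fix i assume i: "i \<in> ?L"
    show "i \<in> ?H \<union> ?I"
    proof (cases "i < n - k")
      case True
      with i high show ?thesis by simp
    next
      case False
      then obtain j where "i = n - k + j" by (metis le_iff_add not_less)
      with i k have "i = n - k + j" "j < k" by auto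
      with i low[of j] show ?thesis by (intro UnI2 image_eqI[of _ _ j]) auto
    qed
  next
    fix i assume "i \<in> ?H \<union> ?I"
    then show "i \<in> ?L" using high low k by auto
  qed
  also have "real (card \<dots>) = real (card ?H) +
      real (card {j. j < k \<and> insert_at j 1 (remove_top 1 (\<theta> \<sigma>)) = \<tau>})"
    by (subst card_Un_disjoint) (auto simp: card_image)
  also have "real (card ?H) = (real n - real k) * (if \<theta> \<sigma> = \<tau> then 1 else 0)"
    using k by auto
  \<comment> \<open>The \<open>n - k\<close> early positions give the lazy weight. The late ones
    carry \<open>k / n\<close>, which is one minus that weight, times the uniform
    \<open>1 / k\<close> of the small chain.\<close>
  finally show ?thesis
    using k by (simp add: \<theta>_def lazy_version_def step field_simps)
qed

section \<open>Binomial-top-to-random\<close>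

definition raise_from :: "nat \<Rightarrow> nat \<Rightarrow> nat" where
  "raise_from a x = (if a \<le> x then Suc x else x)"

lemma strict_mono_raise_from: "strict_mono (raise_from a)"
  by (auto simp: strict_mono_def raise_from_def)

text \<open>Letters below \<open>a\<close> stay and the others move up, which opens a gap at
  \<open>a\<close>. The case \<open>r = 0\<close> describes the fibres; general \<open>r\<close> is
  for the letters above \<open>r\<close>.\<close>

lemma raise_from_image:
  assumes "r < a" "a \<le> Suc k"
  shows "raise_from a ` {Suc r..k} = {Suc r..Suc k} - {a}"
proof (intro equalityI subsetI)
  fix y assume y: "y \<in> {Suc r..Suc k} - {a}"
  show "y \<in> raise_from a ` {Suc r..k}"
  proof (cases "y < a")
    case True
    then show ?thesis using y assms by (intro image_eqI[of _ _ y]) (auto simp: raise_from_def)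
  next
    case False
    then show ?thesis
      using y assms by (intro image_eqI[of _ _ "y - 1"]) (auto simp: raise_from_def)
  qed
qed (use assms in \<open>auto simp: raise_from_def\<close>)

lemma standardise_map_strict_mono: "strict_mono f \<Longrightarrow> standardise (map f xs) = standardise xs"
  by (rule standardise_map) (auto simp: strict_mono_on_def strict_mono_def)

text \<open>Once the first letter \<open>a\<close> is chosen, the letter set of the rest and its
  pattern \<tau> are known, so the rest is determined.\<close>

lemma bij_betw_standardise_tl_fibre:
  assumes "\<tau> \<in> perms k"
  shows "bij_betw (\<lambda>a. a # map (raise_from a) \<tau>) {1..Suc k}
           {\<sigma> \<in> perms (Suc k). standardise (drop 1 \<sigma>) = \<tau>}"
proof (rule bij_betw_imageI)
  show "inj_on (\<lambda>a. a # map (raise_from a) \<tau>) {1..Suc k}"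
    by (auto simp: inj_on_def)
  have im: "raise_from a ` {1..k} = {1..Suc k} - {a}" if "a \<in> {1..Suc k}" for a
    using raise_from_image[of 0 a k] that by simp
  have std: "standardise (map (raise_from a) \<tau>) = \<tau>" for a
    using standardise_eq_self[OF set_perms[OF assms]]
    by (simp add: standardise_map_strict_mono strict_mono_raise_from)
  show "(\<lambda>a. a # map (raise_from a) \<tau>) ` {1..Suc k} =
      {\<sigma> \<in> perms (Suc k). standardise (drop 1 \<sigma>) = \<tau>}"
  proof (intro equalityI subsetI)
    fix \<sigma> assume "\<sigma> \<in> (\<lambda>a. a # map (raise_from a) \<tau>) ` {1..Suc k}"
    then obtain a where a: "a \<in> {1..Suc k}" "\<sigma> = a # map (raise_from a) \<tau>" by auto
    have "set \<sigma> = {1..Suc k}" using a im[OF a(1)] set_perms[OF assms] by auto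
    moreover have "distinct \<sigma>"
      using a im[OF a(1)] set_perms[OF assms] distinct_perms[OF assms]
        strict_mono_imp_inj_on[OF strict_mono_raise_from]
      by (auto simp: distinct_map intro: inj_on_subset)
    ultimately show "\<sigma> \<in> {\<sigma> \<in> perms (Suc k). standardise (drop 1 \<sigma>) = \<tau>}"
      using std a by (simp add: permutations_of_set_def)
  next
    fix \<sigma> assume \<sigma>: "\<sigma> \<in> {\<sigma> \<in> perms (Suc k). standardise (drop 1 \<sigma>) = \<tau>}"
    then have "length \<sigma> = Suc k" using length_perms[of \<sigma> "Suc k"] by simp
    then obtain a \<rho> where a: "\<sigma> = a # \<rho>" by (cases \<sigma>) auto
    have sd: "set \<sigma> = {1..Suc k}" "distinct \<sigma>" using \<sigma> by (auto simp: permutations_of_set_def)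
    have mem: "a \<in> {1..Suc k}" using sd a by auto
    have "map (raise_from a) \<tau> = \<rho>"
    proof (rule standardise_inject)
      show "standardise (map (raise_from a) \<tau>) = standardise \<rho>" using std \<sigma> a by simp
      show "set (map (raise_from a) \<tau>) = set \<rho>"
        using im[OF mem] set_perms[OF assms] sd a by auto
    qed
    with a mem show "\<sigma> \<in> (\<lambda>a. a # map (raise_from a) \<tau>) ` {1..Suc k}" by blast
  qed
qed

section \<open>Retention of the relative order of the letters above r\<close>

definition retains :: "nat \<Rightarrow> nat list \<Rightarrow> nat list \<Rightarrow> bool" where
  "retains r \<sigma> \<tau> \<longleftrightarrow> filter (\<lambda>x. r < x) \<tau> = remove_top r \<sigma>"

text \<open>The fibre is summed over its first letter \<open>a\<close>, split at \<open>r\<close>.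
  The guard \<open>r \<le> k\<close> matters for \<open>r = Suc k\<close>: no letter exceeds
  \<open>r\<close>, yet \<open>retains r\<close> holds with both lists empty. For
  \<open>r = 0\<close> the truncated \<open>r - 1\<close> has coefficient zero.\<close>

lemma retains_fibre_sum:
  assumes \<sigma>: "\<sigma> \<in> perms (Suc k)" and \<tau>: "\<tau> \<in> perms k" and r: "r \<le> Suc k"
  shows "(\<Sum>\<sigma>' | \<sigma>' \<in> perms (Suc k) \<and> standardise (drop 1 \<sigma>') = \<tau>. of_bool (retains r \<sigma> \<sigma>') :: real) =
    real r * of_bool (retains (r - 1) (standardise (drop 1 \<sigma>)) \<tau>) +
    of_bool (r \<le> k \<and> retains r (standardise (drop 1 \<sigma>)) \<tau>)"
proof -
  let ?\<theta> = "standardise (drop 1 \<sigma>)"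
  let ?f = "\<lambda>a. of_bool (retains r \<sigma> (a # map (raise_from a) \<tau>)) :: real"
  \<comment> \<open>The filter removes \<open>a\<close> itself, and each letter of \<tau> that
    survives was at least \<open>r\<close>, hence at least \<open>a\<close>, so it was raised by
    exactly one.\<close>
  have small: "retains r \<sigma> (a # map (raise_from a) \<tau>) \<longleftrightarrow> retains (r - 1) ?\<theta> \<tau>"
    if a: "a \<in> {1..r}" for a
  proof -
    have "filter (\<lambda>x. r < x) (a # map (raise_from a) \<tau>) =
        map (raise_from a) (filter (\<lambda>x. r - 1 < x) \<tau>)"
    proof -
      have "r < raise_from a x \<longleftrightarrow> r - 1 < x" for x
        using a by (auto simp: raise_from_def)
      then show ?thesis using a by (simp add: filter_map comp_def)
    qed
    also have "\<dots> = map Suc (filter (\<lambda>x. r - 1 < x) \<tau>)"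
      using a by (auto simp: raise_from_def)
    finally have 1: "filter (\<lambda>x. r < x) (a # map (raise_from a) \<tau>) =
      map Suc (filter (\<lambda>x. r - 1 < x) \<tau>)" .
    have 2: "remove_top r \<sigma> = map Suc (remove_top (r - 1) ?\<theta>)"
      using a by (auto simp: remove_top_def standardise_drop)
    show ?thesis
      unfolding retains_def 1 2 by (rule inj_map_eq_map) simp
  qed
  \<comment> \<open>Here \<open>a\<close> survives the filter and comes first, so it must be the
    head \<open>p\<close> of \<open>remove_top r \<sigma>\<close>, which exists because
    \<open>r \<le> k\<close>.\<close>
  have large: "sum ?f {Suc r..Suc k} = of_bool (retains r ?\<theta> \<tau>)" if rk: "r \<le> k"
  proof -
    let ?F = "filter (\<lambda>x. r < x) \<tau>" and ?F' = "remove_top r ?\<theta>"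
    note P = remove_top_in_permutations[OF \<sigma> r]
    have "length (remove_top r \<sigma>) = Suc k - r"
      using length_perms[OF \<sigma>] by (simp add: remove_top_def)
    then obtain p P' where p: "remove_top r \<sigma> = p # P'"
      using rk by (cases "remove_top r \<sigma>") auto
    have setP: "set (p # P') = {Suc r..Suc k}" "distinct (p # P')"
      using P p by (auto simp: permutations_of_set_def)
    have pm: "p \<in> {Suc r..Suc k}" using setP(1) by auto
    have th: "?\<theta> \<in> perms k" using perms_standardise_drop[OF \<sigma>, of 1] by simp
    \<comment> \<open>Both lists have the pattern of \<sigma> without its first \<open>r + 1\<close>
      letters, and both have the letters from \<open>r + 1\<close> to \<open>k + 1\<close> except
      \<open>p\<close>.\<close>
    have F': "map (raise_from p) ?F' = P'"
    proof (rule standardise_inject)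
      have "P' = drop 1 (remove_top r \<sigma>)" using p by simp
      then have "standardise P' = standardise (map ((+) r) (drop 1 (standardise (drop r \<sigma>))))"
        by (simp add: remove_top_def drop_map)
      also have "\<dots> = standardise (drop 1 (standardise (drop r \<sigma>)))"
        by (intro standardise_map_strict_mono) (simp add: strict_mono_def)
      also have "\<dots> = standardise (drop (Suc r) \<sigma>)"
        by (simp add: standardise_drop)
      finally have 1: "standardise P' = standardise (drop (Suc r) \<sigma>)" .
      have "standardise (map (raise_from p) ?F') = standardise (map ((+) r) (standardise (drop r ?\<theta>)))"
        unfolding remove_top_def by (rule standardise_map_strict_mono[OF strict_mono_raise_from])
      \<comment> \<open>The vacuous \<open>drop 0\<close> lets \<open>standardise_drop\<close> also
        absorb the nested standardisation.\<close>
      also have "\<dots> = standardise (drop 0 (standardise (drop r ?\<theta>)))"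
        unfolding drop_0 by (intro standardise_map_strict_mono) (simp add: strict_mono_def)
      also have "\<dots> = standardise (drop (Suc r) \<sigma>)"
        unfolding standardise_drop by (simp add: standardise_drop)
      finally show "standardise (map (raise_from p) ?F') = standardise P'" using 1 by simp
      have "set ?F' = {Suc r..k}"
        using remove_top_in_permutations[OF th rk] by (simp add: permutations_of_set_def)
      moreover have "raise_from p ` {Suc r..k} = {Suc r..Suc k} - {p}"
        by (rule raise_from_image) (use pm in auto)
      ultimately show "set (map (raise_from p) ?F') = set P'" using setP by auto
    qed
    have "retains r \<sigma> (a # map (raise_from a) \<tau>) \<longleftrightarrow> a = p \<and> retains r ?\<theta> \<tau>"
      if a: "a \<in> {Suc r..Suc k}" for a
    proof -
      have "r < raise_from a x \<longleftrightarrow> r < x" for x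
        using a by (auto simp: raise_from_def)
      then have keep: "filter (\<lambda>x. r < x) (a # map (raise_from a) \<tau>) = a # map (raise_from a) ?F"
        using a by (simp add: filter_map comp_def)
      have "retains r \<sigma> (a # map (raise_from a) \<tau>) \<longleftrightarrow>
          a = p \<and> map (raise_from p) ?F = map (raise_from p) ?F'"
        unfolding retains_def keep p F' by auto
      then show ?thesis
        using inj_map_eq_map[OF strict_mono_imp_inj_on[OF strict_mono_raise_from]]
        by (simp add: retains_def)
    qed
    then have "sum ?f {Suc r..Suc k} = (\<Sum>a\<in>{Suc r..Suc k}. if a = p then of_bool (retains r ?\<theta> \<tau>) else 0)"
      by (intro sum.cong) auto
    also have "\<dots> = of_bool (retains r ?\<theta> \<tau>)" using pm by (subst sum.delta) auto
    finally show ?thesis .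
  qed
  have "(\<Sum>\<sigma>' | \<sigma>' \<in> perms (Suc k) \<and> standardise (drop 1 \<sigma>') = \<tau>. of_bool (retains r \<sigma> \<sigma>') :: real) =
      sum ?f {1..Suc k}"
    using sum.reindex_bij_betw[OF bij_betw_standardise_tl_fibre[OF \<tau>], of "\<lambda>\<sigma>'. of_bool (retains r \<sigma> \<sigma>') :: real"]
    by simp
  also have "\<dots> = sum ?f {1..r} + sum ?f {Suc r..Suc k}"
  proof -
    have "{1..Suc k} = {1..r} \<union> {Suc r..Suc k}" using r by auto
    then show ?thesis by (simp only:) (rule sum.union_disjoint; auto)
  qed
  also have "sum ?f {1..r} = real r * of_bool (retains (r - 1) ?\<theta> \<tau>)"
    using small by simp
  also have "sum ?f {Suc r..Suc k} = of_bool (r \<le> k \<and> retains r ?\<theta> \<tau>)"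
    using large by (cases "r \<le> k") auto
  finally show ?thesis .
qed

text \<open>Summing \<open>retains_fibre_sum\<close> over all \<tau> gives the recursion N(k+1, r) =
  r N(k, r-1) + N(k, r), which the falling factorial satisfies.\<close>

lemma card_retains:
  assumes "\<sigma> \<in> perms m" "r \<le> m"
  shows "real (card {\<tau> \<in> perms m. retains r \<sigma> \<tau>}) = fact m / fact (m - r)"
  using assms
proof (induction m arbitrary: \<sigma> r)
  case 0
  then have "{\<tau> \<in> perms 0. retains r \<sigma> \<tau>} = {[]}"
    by (auto simp: retains_def remove_top_def standardise_def)
  with 0 show ?case by simp
next
  case (Suc k)
  let ?\<theta> = "\<lambda>\<sigma>. standardise (drop 1 \<sigma>)"
  have card: "real (card {\<tau> \<in> perms m. retains r \<sigma> \<tau>}) = (\<Sum>\<tau>\<in>perms m. of_bool (retains r \<sigma> \<tau>))"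
    for m r \<sigma>
    by (simp add: sum_of_bool_eq Int_def)
  have th: "?\<theta> \<rho> \<in> perms k" if "\<rho> \<in> perms (Suc k)" for \<rho>
    using perms_standardise_drop[OF that, of 1] by simp
  have IH: "(\<Sum>\<tau>\<in>perms k. of_bool (retains s (?\<theta> \<sigma>) \<tau>) :: real) = fact k / fact (k - s)" if "s \<le> k" for s
    using Suc.IH[OF th[OF Suc.prems(1)] that] card by simp
  have "(\<Sum>\<sigma>'\<in>perms (Suc k). of_bool (retains r \<sigma> \<sigma>') :: real) =
      (\<Sum>\<tau>\<in>perms k. \<Sum>\<sigma>' | \<sigma>' \<in> perms (Suc k) \<and> ?\<theta> \<sigma>' = \<tau>. of_bool (retains r \<sigma> \<sigma>'))"
    by (rule sum.group[symmetric]) (use th in auto)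
  also have "\<dots> = real r * (\<Sum>\<tau>\<in>perms k. of_bool (retains (r - 1) (?\<theta> \<sigma>) \<tau>)) +
      (\<Sum>\<tau>\<in>perms k. of_bool (r \<le> k \<and> retains r (?\<theta> \<sigma>) \<tau>))"
    using Suc.prems by (simp add: retains_fibre_sum[simplified] sum.distrib sum_distrib_left)
  also have "\<dots> = real r * (fact k / fact (k - (r - 1))) + (if r \<le> k then fact k / fact (k - r) else 0)"
    using Suc.prems IH[of r] IH[of "r - 1"] by auto
  also have "\<dots> = fact (Suc k) / fact (Suc k - r)"
  \<comment> \<open>In the extreme cases one summand vanishes. Otherwise put
    \<open>e = k - r\<close>; the claim is \<open>k + 1 = r + (e + 1)\<close> multiplied by
    k!/(e+1)!.\<close>
  proof (cases "r = 0 \<or> r = Suc k")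
    case True
    then show ?thesis by auto
  next
    case False
    with Suc.prems obtain e where e: "k = r + e" by (metis le_SucE le_iff_add)
    then have eqs: "k - (r - 1) = Suc e" "Suc k - r = Suc e" "k - r = e" using False by auto
    have "fact k / fact e = real (Suc e) * fact k / fact (Suc e)"
      by (simp del: of_nat_Suc)
    moreover have "(fact (Suc k) :: real) = real r * fact k + real (Suc e) * fact k"
      using e by (simp add: algebra_simps)
    ultimately show ?thesis
      unfolding eqs using e by (simp add: add_divide_distrib del: fact_Suc of_nat_Suc)
  qed
  finally show ?case by (simp only: card)
qed

section \<open>Transition probabilities of the binomial chain\<close>

lemma binomial_top_to_random_eq:
  assumes q: "0 \<le> q" "q \<le> 1" and \<sigma>: "\<sigma> \<in> perms m" and \<tau>: "\<tau> \<in> perms m"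
  shows "binomial_top_to_random m q \<sigma> \<tau> =
    (\<Sum>r\<le>m. (1 - q) ^ r * q ^ (m - r) / fact r * of_bool (retains r \<sigma> \<tau>))"
proof -
  let ?A = "\<lambda>r. {\<tau> \<in> perms m. filter (\<lambda>x. r < x) \<tau> = remove_top r \<sigma>}"
  have "binomial_top_to_random m q \<sigma> \<tau> =
      (\<Sum>r\<le>m. pmf (pmf_of_set (?A r)) \<tau> * pmf (binomial_pmf m (1 - q)) r)"
    unfolding binomial_top_to_random_def binomial_top_to_random_step_def pmf_bind
    by (rule integral_measure_pmf_real) (use q set_pmf_binomial_eq[of "1 - q" m] in \<open>auto split: if_splits\<close>)
  \<comment> \<open>The uniform weight (m-r)!/m! cancels all of the binomial coefficient except
    1/r!.\<close>
  also have "\<dots> = (\<Sum>r\<le>m. (1 - q) ^ r * q ^ (m - r) / fact r * of_bool (retains r \<sigma> \<tau>))"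
  proof (rule sum.cong[OF refl])
    fix r assume "r \<in> {..m}"
    then have r: "r \<le> m" by simp
    have card: "real (card (?A r)) = fact m / fact (m - r)"
      using card_retains[OF \<sigma> r] by (simp add: retains_def)
    \<comment> \<open>The positive count shows that the set is nonempty, as the formula for
      \<open>pmf_of_set\<close> requires.\<close>
    then have "real (card (?A r)) \<noteq> 0" by simp
    then have "?A r \<noteq> {}" by (metis card.empty of_nat_0)
    then have "pmf (pmf_of_set (?A r)) \<tau> = of_bool (retains r \<sigma> \<tau>) * fact (m - r) / fact m"
      by (subst pmf_of_set, assumption, simp, subst card) (use \<tau> in \<open>simp add: retains_def\<close>)
    moreover have "pmf (binomial_pmf m (1 - q)) r =
        fact m / (fact r * fact (m - r)) * (1 - q) ^ r * q ^ (m - r)"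
      using q r by (simp add: binomial_fact)
    ultimately show "pmf (pmf_of_set (?A r)) \<tau> * pmf (binomial_pmf m (1 - q)) r =
        (1 - q) ^ r * q ^ (m - r) / fact r * of_bool (retains r \<sigma> \<tau>)"
      by (simp only:) simp
  qed
  finally show ?thesis .
qed

lemma binomial_top_to_random_fibre_sum_tl:
  assumes q: "0 \<le> q" "q \<le> 1" and \<sigma>: "\<sigma> \<in> perms (Suc k)" and \<tau>: "\<tau> \<in> perms k"
  shows "(\<Sum>\<sigma>' | \<sigma>' \<in> perms (Suc k) \<and> standardise (drop 1 \<sigma>') = \<tau>.
      binomial_top_to_random (Suc k) q \<sigma> \<sigma>') = binomial_top_to_random k q (standardise (drop 1 \<sigma>)) \<tau>"
proof -
  let ?\<theta> = "standardise (drop 1 \<sigma>)"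
  define w where "w m r = (1 - q) ^ r * q ^ (m - r) / fact r" for m r
  define B where "B r = (of_bool (retains r ?\<theta> \<tau>) :: real)" for r
  have th: "?\<theta> \<in> perms k" using perms_standardise_drop[OF \<sigma>, of 1] by simp
  have "(\<Sum>\<sigma>' | \<sigma>' \<in> perms (Suc k) \<and> standardise (drop 1 \<sigma>') = \<tau>.
      binomial_top_to_random (Suc k) q \<sigma> \<sigma>') =
      (\<Sum>\<sigma>' | \<sigma>' \<in> perms (Suc k) \<and> standardise (drop 1 \<sigma>') = \<tau>.
        \<Sum>r\<le>Suc k. w (Suc k) r * of_bool (retains r \<sigma> \<sigma>'))"
    unfolding w_def by (intro sum.cong refl binomial_top_to_random_eq q \<sigma>) simp
  also have "\<dots> = (\<Sum>r\<le>Suc k. w (Suc k) r *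
      (\<Sum>\<sigma>' | \<sigma>' \<in> perms (Suc k) \<and> standardise (drop 1 \<sigma>') = \<tau>. of_bool (retains r \<sigma> \<sigma>')))"
    by (subst sum.swap) (simp only: sum_distrib_left)
  also have "\<dots> = (\<Sum>r\<le>Suc k. w (Suc k) r * (real r * B (r - 1) + of_bool (r \<le> k) * B r))"
  proof (intro sum.cong refl arg_cong2[where f = "(*)"])
    fix r assume "r \<in> {..Suc k}"
    then show "(\<Sum>\<sigma>' | \<sigma>' \<in> perms (Suc k) \<and> standardise (drop 1 \<sigma>') = \<tau>. of_bool (retains r \<sigma> \<sigma>')) =
        real r * B (r - 1) + of_bool (r \<le> k) * B r"
      using retains_fibre_sum[OF \<sigma> \<tau>, of r] by (simp add: B_def of_bool_conj)
  qed
  also have "\<dots> = (\<Sum>r\<le>Suc k. w (Suc k) r * real r * B (r - 1)) +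
      (\<Sum>r\<le>Suc k. w (Suc k) r * of_bool (r \<le> k) * B r)"
    by (simp only: distrib_left sum.distrib mult.assoc)
  \<comment> \<open>The term at \<open>r = 0\<close> vanishes. After the shift, the factor
    \<open>Suc r\<close> cancels against the factorial and one factor \<open>1 - q\<close> is left
    over.\<close>
  also have "(\<Sum>r\<le>Suc k. w (Suc k) r * real r * B (r - 1)) = (\<Sum>r\<le>k. (1 - q) * (w k r * B r))"
  proof -
    have "w (Suc k) (Suc r) * real (Suc r) = (1 - q) * w k r" for r
      by (simp add: w_def del: of_nat_Suc)
    then show ?thesis by (subst sum.atMost_Suc_shift) (simp add: mult.assoc del: of_nat_Suc)
  qed
  \<comment> \<open>The indicator kills \<open>r = Suc k\<close>; for the other \<open>r\<close> the
    exponent of \<open>q\<close> is one larger than in \<open>w k r\<close>.\<close>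
  also have "(\<Sum>r\<le>Suc k. w (Suc k) r * of_bool (r \<le> k) * B r) = (\<Sum>r\<le>k. q * (w k r * B r))"
    by (auto simp: w_def Suc_diff_le intro!: sum.cong)
  also have "(\<Sum>r\<le>k. (1 - q) * (w k r * B r)) + (\<Sum>r\<le>k. q * (w k r * B r)) = (\<Sum>r\<le>k. w k r * B r)"
    by (simp only: sum.distrib[symmetric]) (simp add: algebra_simps)
  also have "\<dots> = binomial_top_to_random k q ?\<theta> \<tau>"
    unfolding binomial_top_to_random_eq[OF q th \<tau>] w_def B_def ..
  finally show ?thesis .
qed

text \<open>Letters are dropped one at a time, by induction on \<open>d\<close>; lumpings compose
  because standardisation commutes with dropping.\<close>

lemma binomial_top_to_random_fibre_sum:
  assumes q: "0 \<le> q" "q \<le> 1" and "\<sigma> \<in> perms (k + d)" and \<tau>: "\<tau> \<in> perms k"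
  shows "(\<Sum>\<sigma>' | \<sigma>' \<in> perms (k + d) \<and> standardise (drop d \<sigma>') = \<tau>.
      binomial_top_to_random (k + d) q \<sigma> \<sigma>') = binomial_top_to_random k q (standardise (drop d \<sigma>)) \<tau>"
  using assms(3)
proof (induction d arbitrary: \<sigma>)
  case 0
  have std: "standardise \<rho> = \<rho>" if "\<rho> \<in> perms k" for \<rho>
    using standardise_eq_self[OF set_perms[OF that]] .
  then have "{\<sigma>'. \<sigma>' \<in> perms (k + 0) \<and> standardise (drop 0 \<sigma>') = \<tau>} = {\<tau>}"
    using \<tau> by auto
  with 0 std show ?case by simp
next
  case (Suc d)
  let ?\<theta> = "\<lambda>\<sigma>. standardise (drop 1 \<sigma>)"
  let ?K = "\<lambda>m. binomial_top_to_random m q"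
  have th: "?\<theta> \<rho> \<in> perms (k + d)" if "\<rho> \<in> perms (Suc (k + d))" for \<rho>
    using perms_standardise_drop[OF that, of 1] by simp
  have comp: "standardise (drop d (?\<theta> \<rho>)) = standardise (drop (Suc d) \<rho>)" for \<rho>
    by (simp add: standardise_drop)
  have \<sigma>: "\<sigma> \<in> perms (Suc (k + d))" using Suc.prems by simp
  \<comment> \<open>The fibre for \<open>d + 1\<close> letters is partitioned by the intermediate
    permutation \<rho> left after dropping one letter.\<close>
  have "(\<Sum>\<sigma>' | \<sigma>' \<in> perms (Suc (k + d)) \<and> standardise (drop (Suc d) \<sigma>') = \<tau>. ?K (Suc (k + d)) \<sigma> \<sigma>') =
      (\<Sum>\<rho> | \<rho> \<in> perms (k + d) \<and> standardise (drop d \<rho>) = \<tau>.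
        \<Sum>\<sigma>' | \<sigma>' \<in> {\<sigma>' \<in> perms (Suc (k + d)). standardise (drop (Suc d) \<sigma>') = \<tau>} \<and> ?\<theta> \<sigma>' = \<rho>.
          ?K (Suc (k + d)) \<sigma> \<sigma>')"
    by (rule sum.group[symmetric]) (use th comp in auto)
  also have "\<dots> = (\<Sum>\<rho> | \<rho> \<in> perms (k + d) \<and> standardise (drop d \<rho>) = \<tau>. ?K (k + d) (?\<theta> \<sigma>) \<rho>)"
  proof (rule sum.cong[OF refl])
    fix \<rho> assume \<rho>: "\<rho> \<in> {\<rho>. \<rho> \<in> perms (k + d) \<and> standardise (drop d \<rho>) = \<tau>}"
    \<comment> \<open>Every \<sigma>' above \<rho> meets the outer condition, because \<rho> lies in
      the fibre of \<tau>.\<close>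
    then have "{\<sigma>'. \<sigma>' \<in> {\<sigma>' \<in> perms (Suc (k + d)). standardise (drop (Suc d) \<sigma>') = \<tau>} \<and> ?\<theta> \<sigma>' = \<rho>} =
        {\<sigma>'. \<sigma>' \<in> perms (Suc (k + d)) \<and> ?\<theta> \<sigma>' = \<rho>}"
      using comp by auto
    then show "(\<Sum>\<sigma>' | \<sigma>' \<in> {\<sigma>' \<in> perms (Suc (k + d)). standardise (drop (Suc d) \<sigma>') = \<tau>} \<and> ?\<theta> \<sigma>' = \<rho>.
        ?K (Suc (k + d)) \<sigma> \<sigma>') = ?K (k + d) (?\<theta> \<sigma>) \<rho>"
      using binomial_top_to_random_fibre_sum_tl[OF q \<sigma>, of \<rho>] \<rho> by simp
  qed
  also have "\<dots> = ?K k (standardise (drop d (?\<theta> \<sigma>))) \<tau>"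
    by (rule Suc.IH) (rule th[OF \<sigma>])
  finally show ?case by (simp only: comp add_Suc_right)
qed

theorem theorem6p2:
  fixes n k :: nat and q\<^sub>2 :: real and \<theta> :: "nat list \<Rightarrow> nat list"
  assumes "1 \<le> k" and "k \<le> n" and "0 \<le> q\<^sub>2" and "q\<^sub>2 \<le> 1"
  defines "\<theta> \<equiv> (\<lambda>\<sigma>. standardise (drop (n - k) \<sigma>))"
  shows "lumps_via TYPE('w) (perms n) (top_to_random n) \<theta>
           (perms k) (lazy_version ((real n - real k) / real n) (top_to_random k)) \<and>
         lumps_via TYPE('w) (perms n) (binomial_top_to_random n q\<^sub>2) \<theta>
           (perms k) (binomial_top_to_random k q\<^sub>2)"
proof
  have onto: "\<theta> ` perms n = perms k"
    unfolding \<theta>_def by (rule standardise_drop_image_perms) fact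
  show "lumps_via TYPE('w) (perms n) (top_to_random n) \<theta>
           (perms k) (lazy_version ((real n - real k) / real n) (top_to_random k))"
    unfolding \<theta>_def
    by (rule lumps_via_fibre_sums[OF onto[unfolded \<theta>_def]])
      (rule top_to_random_fibre_sum[OF assms(1,2)])
  show "lumps_via TYPE('w) (perms n) (binomial_top_to_random n q\<^sub>2) \<theta>
           (perms k) (binomial_top_to_random k q\<^sub>2)"
    by (rule lumps_via_fibre_sums[OF onto])
      (use assms(2-4) binomial_top_to_random_fibre_sum[of q\<^sub>2 _ k "n - k"] in \<open>simp add: \<theta>_def\<close>)
qed

end
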